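(* Let $d\ge1$, $x_0\in\mathbb{R}^d$, and let $\alpha\in(0,2)$, $\beta\in(0,\alpha)$, $T\in(0,\infty)$ be constants. For $n\in\mathbb{N}$ let $\eta=T/n$ be the step size. (i) Let $(Y_k)_{0\le k\le n}$ be the scheme $$Y_{k+1}=Y_k-\eta Y_k\log(1+|Y_k|)+\big(Z_{(k+1)\eta}-Z_{k\eta}\big),\qquad Y_0=x_0,$$ where $(Z_t)_{t\ge0}$ is the standard rotationally symmetric $\alpha$-stable process on $\mathbb{R}^d$. Define $K_1=2(\mathrm{e}^{\delta_\alpha/\beta}+2)/T$. Assume that $T$ and $n$ are large enough such that $$\frac{T}{n}\le 1,\qquad K_1<\frac{\delta_\alpha-\log\delta_\alpha}{\alpha-\beta},\qquad \mathrm{e}^{nK_1}\ge |x_0|\big(1+\log(1+|x_0|)\big).$$ Then there exist a constant $C>0$ (independent of $n$) and a sequence of non-empty events $\Omega_n\subseteq\Omega$, $n\in\mathbb{N}$, with $$\mathbb{P}(\Omega_n)\ge \frac{C\,\mathrm{e}^{-\alpha nK_1}}{n\,\delta_\alpha^{n}}\quad\text{and}\quad |Y_n(\omega)|\ge \exp\Big\{nK_1+(n-1)\frac{\delta_\alpha}{\beta}\Big\}$$ for all $\omega\in\Omega_n$ and all $n\in\mathbb{N}$ large enough. Consequently, $\lim_{n\to\infty}\mathbb{E}|Y_n|^\beta=\infty$. (ii) Let $(\widetilde Y_k)_{0\le k\le n}$ be the scheme $$\widetilde Y_{k+1}=\widetilde Y_k-\eta\widetilde Y_k\log(1+|\widetilde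 Y_k|)+\frac1\sigma\eta^{1/\alpha}\widetilde Z_{k+1},\qquad \widetilde Y_0=x_0,$$ where $\widetilde Z_1,\widetilde Z_2,\dots$ are i.i.d. Pareto-distributed random vectors in $\mathbb{R}^d$ with parameter $\alpha$. Define $K_2=2(\mathrm{e}^{\kappa_\alpha/\beta}+2/\sigma)/T$. Assume that $T$ and $n$ are large enough such that $$\frac{T}{n}\le 1,\qquad K_2<\frac{\kappa_\alpha-\log\kappa_\alpha}{\alpha-\beta},\qquad \mathrm{e}^{nK_2}\ge |x_0|\big(1+\log(1+|x_0|)\big).$$ Then there exist a constant $C>0$ (independent of $n$) and a sequence of non-empty events $\widetilde\Omega_n\subseteq\Omega$, $n\in\mathbb{N}$, with $$\mathbb{P}(\widetilde\Omega_n)\ge \frac{C\,\mathrm{e}^{-\alpha nK_2}}{n\,\kappa_\alpha^{n}}\quad\text{and}\quad |\widetilde Y_n(\omega)|\ge \exp\Big\{nK_2+(n-1)\frac{\kappa_\alpha}{\beta}\Big\}$$ for all $\omega\in\widetilde\Omega_n$ and all $n\in\mathbb{N}$ large enough. Consequently, $\lim_{n\to\infty}\mathbb{E}|\widetilde Y_n|^\beta=\infty$.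
   Context: All random variables live on a probability space $(\Omega,\mathcal F,\mathbb P)$; $|\cdot|$ is the Euclidean norm. For each $n$ the schemes are run with step size $\eta=T/n$, so $Y_n$ (resp. $\widetilde Y_n$) is the $n$-th iterate of the scheme with step size $T/n$; expectations take values in $[0,\infty]$. Stable process: $(Z_t)_{t\ge0}$ is the standard $d$-dimensional rotationally symmetric (invariant) $\alpha$-stable Lévy process, with Lévy measure $\nu(\mathrm{d}z)=C_{d,\alpha}|z|^{-d-\alpha}\,\mathrm{d}z$, where $$C_{d,\alpha}=\alpha 2^{\alpha-1}\pi^{-d/2}\,\frac{\Gamma((d+\alpha)/2)}{\Gamma(1-\alpha/2)}$$ (equivalently $\mathbb{E}\,\mathrm{e}^{i\langle\xi,Z_t\rangle}=\mathrm{e}^{-t|\xi|^\alpha}$). Its transition density $p_\alpha(t,x)$ satisfies, for a constant $K(d,\alpha)\ge1$ depending only on $d$ and $\alpha$ (fixed throughout), $$K(d,\alpha)^{-1}\frac{t}{(t^{1/\alpha}+|x|)^{d+\alpha}}\le p_\alpha(t,x)\le K(d,\alpha)\frac{t}{(t^{1/\alpha}+|x|)^{d+\alpha}},\qquad t>0,\ x\in\mathbb{R}^d.$$ Pareto distribution with parameter $\alpha$ on $\mathbb{R}^d$: the distribution with density $p(z)=\dfrac{\alpha}{s_{d-1}|z|^{\alpha+d}}\mathbf 1_{(1,\infty)}(|z|)$, where $s_{d-1}=2\pi^{d/2}/\Gamma(d/2)$ is the surface area of the unit sphere in $\mathbb{R}^d$. Constants: $\sigma>0$ is defined by $\sigma^\alpha=\alpha/(s_{d-1}C_{d,\alpha})$;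 $\kappa_\alpha=2^\alpha/(2^\alpha-1)$; $\delta_\alpha=\dfrac{2^{d+\alpha}\alpha K(d,\alpha)}{s_{d-1}}\big(1-2^{-\alpha}\big)^{-1}$. *)

theory Defs
  imports "HOL-Probability.Probability"
begin

subsection \<open>Constants\<close>

text \<open>Surface area \<open>s\<^sub>d\<^sub>-\<^sub>1\<close> of the unit sphere in \<open>d\<close>-dimensional Euclidean space;
  the argument is the dimension \<open>d\<close> of the space, not of the sphere.\<close>

definition sphere_area :: "nat \<Rightarrow> real" where
  "sphere_area d = 2 * pi powr (real d / 2) / Gamma (real d / 2)"

text \<open>\<open>C\<^sub>d\<^sub>,\<^sub>\<alpha>\<close>: the standard isotropic stable process has Levy measure
  \<open>C\<^sub>d\<^sub>,\<^sub>\<alpha> |z|\<^sup>-\<^sup>d\<^sup>-\<^sup>\<alpha> dz\<close>.\<close>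

definition levy_const :: "nat \<Rightarrow> real \<Rightarrow> real" where
  "levy_const d \<alpha> =
     \<alpha> * 2 powr (\<alpha> - 1) * pi powr (- real d / 2) * Gamma ((real d + \<alpha>) / 2) / Gamma (1 - \<alpha> / 2)"

text \<open>The positive solution of \<open>\<sigma>\<^sup>\<alpha> = \<alpha> / (s\<^sub>d\<^sub>-\<^sub>1 C\<^sub>d\<^sub>,\<^sub>\<alpha>)\<close>.\<close>

definition sigma_const :: "nat \<Rightarrow> real \<Rightarrow> real" where
  "sigma_const d \<alpha> = (\<alpha> / (sphere_area d * levy_const d \<alpha>)) powr (1 / \<alpha>)"

definition kappa_const :: "real \<Rightarrow> real" where
  "kappa_const \<alpha> = 2 powr \<alpha> / (2 powr \<alpha> - 1)"

text \<open>Here \<open>K\<close> stands for the heat kernel constant \<open>K(d,\<alpha>)\<close>.\<close>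

definition delta_const :: "nat \<Rightarrow> real \<Rightarrow> real \<Rightarrow> real" where
  "delta_const d \<alpha> K =
     2 powr (real d + \<alpha>) * \<alpha> * K / sphere_area d * inverse (1 - 2 powr (- \<alpha>))"

definition K1_const :: "nat \<Rightarrow> real \<Rightarrow> real \<Rightarrow> real \<Rightarrow> real \<Rightarrow> real" where
  "K1_const d \<alpha> \<beta> K T = 2 * (exp (delta_const d \<alpha> K / \<beta>) + 2) / T"

definition K2_const :: "nat \<Rightarrow> real \<Rightarrow> real \<Rightarrow> real \<Rightarrow> real" where
  "K2_const d \<alpha> \<beta> T = 2 * (exp (kappa_const \<alpha> / \<beta>) + 2 / sigma_const d \<alpha>) / T"

subsection \<open>Stable processes\<close>

text \<open>Only the times \<open>t \<ge> 0\<close> are relevant. The clauses are: random vectors, start at 0,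
  independent increments, stationary increments, and right-continuous paths with left limits.\<close>

definition levy_process :: "'w measure \<Rightarrow> (real \<Rightarrow> 'w \<Rightarrow> 'a::euclidean_space) \<Rightarrow> bool" where
  "levy_process M Z \<longleftrightarrow>
     (\<forall>t\<ge>0. Z t \<in> borel_measurable M) \<and>
     (AE \<omega> in M. Z 0 \<omega> = 0) \<and>
     (\<forall>(t :: nat \<Rightarrow> real) m. 0 \<le> t 0 \<and> mono t \<longrightarrow>
        prob_space.indep_vars M (\<lambda>_. borel) (\<lambda>i \<omega>. Z (t (Suc i)) \<omega> - Z (t i) \<omega>) {..<m}) \<and>
     (\<forall>s\<ge>0. \<forall>t\<ge>0. distr M borel (\<lambda>\<omega>. Z (s + t) \<omega> - Z s \<omega>) = distr M borel (Z t)) \<and>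
     (AE \<omega> in M. (\<forall>t\<ge>0. ((\<lambda>s. Z s \<omega>) \<longlongrightarrow> Z t \<omega>) (at_right t)) \<and>
                 (\<forall>t>0. \<exists>l. ((\<lambda>s. Z s \<omega>) \<longlongrightarrow> l) (at_left t)))"

text \<open>The standard rotationally symmetric \<open>\<alpha>\<close>-stable process, with the normalisation expressed
  by the characteristic function; equivalently, its Levy measure is
  \<open>C\<^sub>d\<^sub>,\<^sub>\<alpha> |z|\<^sup>-\<^sup>d\<^sup>-\<^sup>\<alpha> dz\<close> (with no drift and no Gaussian part).\<close>

definition isotropic_stable_process ::
    "'w measure \<Rightarrow> real \<Rightarrow> (real \<Rightarrow> 'w \<Rightarrow> 'a::euclidean_space) \<Rightarrow> bool" where
  "isotropic_stable_process M \<alpha> Z \<longleftrightarrow>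
     levy_process M Z \<and>
     (\<forall>t\<ge>0. \<forall>\<xi>. (\<integral>\<omega>. exp (\<i> * complex_of_real (\<xi> \<bullet> Z t \<omega>)) \<partial>M)
                = complex_of_real (exp (- t * norm \<xi> powr \<alpha>)))"

text \<open>By stationarity of the increments and \<open>Z\<^sub>0 = 0\<close>, the transition density of a Levy process
  at time \<open>t\<close> is the density of \<open>Z\<^sub>t\<close>.\<close>

definition transition_density ::
    "'w measure \<Rightarrow> (real \<Rightarrow> 'w \<Rightarrow> 'a::euclidean_space) \<Rightarrow> (real \<Rightarrow> 'a \<Rightarrow> real) \<Rightarrow> bool" where
  "transition_density M Z p \<longleftrightarrow>
     (\<forall>t>0. (\<forall>x. 0 \<le> p t x) \<and> distributed M lborel (Z t) (\<lambda>x. ennreal (p t x)))"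

definition heat_kernel_bounds ::
    "real \<Rightarrow> real \<Rightarrow> (real \<Rightarrow> 'a::euclidean_space \<Rightarrow> real) \<Rightarrow> bool" where
  "heat_kernel_bounds \<alpha> K p \<longleftrightarrow>
     (\<forall>t>0. \<forall>x.
        inverse K * (t / (t powr (1 / \<alpha>) + norm x) powr (real DIM('a) + \<alpha>)) \<le> p t x \<and>
        p t x \<le> K * (t / (t powr (1 / \<alpha>) + norm x) powr (real DIM('a) + \<alpha>)))"

subsection \<open>Pareto vectors\<close>

definition pareto_density :: "real \<Rightarrow> 'a::euclidean_space \<Rightarrow> real" where
  "pareto_density \<alpha> z =
     \<alpha> / (sphere_area DIM('a) * norm z powr (\<alpha> + real DIM('a))) * indicator {1<..} (norm z)"

text \<open>The sequence is indexed from 1; the value at index 0 is irrelevant.\<close>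

definition iid_pareto ::
    "'w measure \<Rightarrow> real \<Rightarrow> (nat \<Rightarrow> 'w \<Rightarrow> 'a::euclidean_space) \<Rightarrow> bool" where
  "iid_pareto M \<alpha> Z \<longleftrightarrow>
     prob_space.indep_vars M (\<lambda>_. borel) Z {1..} \<and>
     (\<forall>k\<ge>1. distributed M lborel (Z k) (\<lambda>z. ennreal (pareto_density \<alpha> z)))"

subsection \<open>The two schemes, with step size \<open>\<eta>\<close>\<close>

primrec stable_scheme ::
    "real \<Rightarrow> 'a::euclidean_space \<Rightarrow> (real \<Rightarrow> 'w \<Rightarrow> 'a) \<Rightarrow> nat \<Rightarrow> 'w \<Rightarrow> 'a" where
  "stable_scheme \<eta> x0 Z 0 \<omega> = x0"
| "stable_scheme \<eta> x0 Z (Suc k) \<omega> =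
     stable_scheme \<eta> x0 Z k \<omega>
     - (\<eta> * ln (1 + norm (stable_scheme \<eta> x0 Z k \<omega>))) *\<^sub>R stable_scheme \<eta> x0 Z k \<omega>
     + (Z (real (k + 1) * \<eta>) \<omega> - Z (real k * \<eta>) \<omega>)"

primrec pareto_scheme ::
    "real \<Rightarrow> real \<Rightarrow> 'a::euclidean_space \<Rightarrow> (nat \<Rightarrow> 'w \<Rightarrow> 'a) \<Rightarrow> nat \<Rightarrow> 'w \<Rightarrow> 'a" where
  "pareto_scheme \<alpha> \<eta> x0 Z 0 \<omega> = x0"
| "pareto_scheme \<alpha> \<eta> x0 Z (Suc k) \<omega> =
     pareto_scheme \<alpha> \<eta> x0 Z k \<omega>
     - (\<eta> * ln (1 + norm (pareto_scheme \<alpha> \<eta> x0 Z k \<omega>))) *\<^sub>R pareto_scheme \<alpha> \<eta> x0 Z k \<omega>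
     + (1 / sigma_const DIM('a) \<alpha> * \<eta> powr (1 / \<alpha>)) *\<^sub>R Z (k + 1) \<omega>"

end

theory Submission
  imports Defs "HOL-Real_Asymp.Real_Asymp"
begin

text \<open>Both schemes have the form \<open>y (k + 1) = y k - \<eta> * ln (1 + norm (y k)) * y k + \<xi> (k + 1)\<close> with step size
\<open>\<eta> = T / n\<close> and independent heavy-tailed noise \<open>\<xi>\<close>. The exact flow would be contracted by the drift, but the explicit
step overshoots: as soon as \<open>\<eta> * ln (1 + norm (y k))\<close> is well above 2, the norm of the next iterate is larger than the
present one, and the effect feeds itself. This happens once one noise vector has norm of order \<open>exp (n * K)\<close>, since then
\<open>\<eta> * ln (1 + norm (y k)) \<ge> T * K\<close>, a quantity that does not depend on \<open>n\<close> and was chosen so large that every later step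
multiplies the norm by \<open>exp (\<gamma> / \<beta>)\<close>, even against noise of bounded size
(lemma \<open>superlinear_scheme_growth\<close>).

Power-law tails make the initial jump affordable: it has probability of order \<open>exp (- \<alpha> * n * K) / n\<close>. Each
later noise vector is small with probability at least \<open>1 / \<gamma>\<close>, where \<open>\<gamma>\<close> is \<open>\<delta>\<^sub>\<alpha>\<close> for the stable and \<open>\<kappa>\<^sub>\<alpha>\<close> for the
Pareto scheme. The \<open>\<beta>\<close>-th power of the final iterate on this event is of order \<open>exp (\<beta> * n * K + n * \<gamma>)\<close>, so the
\<open>\<beta>\<close>-th moment is at least of order \<open>exp (n * (\<gamma> - ln \<gamma> - (\<alpha> - \<beta>) * K)) / n\<close>, which diverges. This argument is carried
out once, for arbitrary noise with these two probability bounds, in \<open>superlinear_scheme_moment_explosion\<close>.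

For both noises, both probability bounds come from the same computation, the mass of a dyadic shell \<open>a < norm x \<le> 2 * a\<close> under
a density bounded below by a power law (lemma \<open>prob_dyadic_shell_ge\<close>). This in turn rests on integration in
polar coordinates, which is obtained here for radial functions from the volume of balls.\<close>

section \<open>Radial integrals over spherical shells\<close>

lemma sphere_area_pos: "0 < d \<Longrightarrow> 0 < sphere_area d"
  by (simp add: sphere_area_def)

lemma sphere_area_eq_unit_ball_vol:
  assumes "0 < d"
  shows "sphere_area d = real d * unit_ball_vol (real d)"
proof -
  have "real d / 2 \<notin> \<int>\<^sub>\<le>\<^sub>0"
    using assms by (auto elim!: nonpos_Ints_cases)
  moreover have "Gamma (real d / 2) > 0"
    using assms by simp
  ultimately show ?thesis
    using assms by (simp add: sphere_area_def unit_ball_vol_def Gamma_plus1 del: add_divide_distrib)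
qed

lemma emeasure_shell:
  fixes a b :: real
  assumes "0 \<le> a" "a \<le> b"
  shows "emeasure lborel {x::'a::euclidean_space. a < norm x \<and> norm x \<le> b}
         = ennreal (unit_ball_vol DIM('a) * (b ^ DIM('a) - a ^ DIM('a)))"
proof -
  have "{x::'a. a < norm x \<and> norm x \<le> b} = cball 0 b - cball 0 a"
    by auto
  also have "emeasure lborel \<dots> = emeasure lborel (cball (0::'a) b) - emeasure lborel (cball (0::'a) a)"
    using assms by (intro emeasure_Diff) (auto simp: emeasure_cball)
  also have "\<dots> = ennreal (unit_ball_vol DIM('a) * (b ^ DIM('a) - a ^ DIM('a)))"
    using assms by (simp add: emeasure_cball ennreal_minus right_diff_distrib)
  finally show ?thesis .
qed

text \<open>The weight on the left is the derivative of the volume \<open>unit_ball_vol d * r ^ d\<close> of a ball as a function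
of its radius, so its integral agrees with the volume of a shell.\<close>

lemma nn_integral_radial_weight:
  fixes a b :: real
  assumes "0 \<le> a" "a \<le> b" "0 < d"
  shows "(\<integral>\<^sup>+r. ennreal (sphere_area d * r ^ (d - 1)) * indicator {a<..b} r \<partial>lborel)
         = ennreal (unit_ball_vol d * (b ^ d - a ^ d))"
proof -
  have "(\<integral>\<^sup>+r. ennreal (sphere_area d * r ^ (d - 1)) * indicator {a<..b} r \<partial>lborel)
      = (\<integral>\<^sup>+r. ennreal (sphere_area d * r ^ (d - 1)) * indicator {a..b} r \<partial>lborel)"
    using AE_lborel_singleton[of a]
    by (intro nn_integral_cong_AE, eventually_elim) (auto split: split_indicator)
  also have "\<dots> = ennreal (unit_ball_vol d * b ^ d - unit_ball_vol d * a ^ d)"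
  proof (rule nn_integral_FTC_Icc)
    fix r :: real assume r: "r \<in> {a..b}"
    show "((\<lambda>r. unit_ball_vol (real d) * r ^ d) has_real_derivative sphere_area d * r ^ (d - 1)) (at r)"
      using assms by (auto intro!: derivative_eq_intros simp: sphere_area_eq_unit_ball_vol)
    show "0 \<le> sphere_area d * r ^ (d - 1)"
      using r assms sphere_area_pos[of d] by auto
  qed (use assms in auto)
  finally show ?thesis
    by (simp add: right_diff_distrib)
qed

text \<open>Polar coordinates for radial functions. The push-forward of Lebesgue measure on the shell under the norm
and the measure on the line with the radial weight give the same, finite, mass to every half-line, hence
coincide. Working on a bounded shell is what makes these masses finite.\<close>

lemma nn_integral_radial_shell:
  fixes f :: "real \<Rightarrow> ennreal"
  assumes [measurable]: "f \<in> borel_measurable borel" and ab: "0 \<le> a" "a \<le> b"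
  shows "(\<integral>\<^sup>+x. f (norm x) * indicator {a<..b} (norm x) \<partial>(lborel :: 'a::euclidean_space measure))
       = (\<integral>\<^sup>+r. f r * (ennreal (sphere_area DIM('a) * r ^ (DIM('a) - 1)) * indicator {a<..b} r) \<partial>lborel)"
proof -
  define \<mu> where "\<mu> = distr (density lborel (\<lambda>x::'a. indicator {a<..b} (norm x))) borel (norm :: 'a \<Rightarrow> real)"
  define \<nu> where "\<nu> = density lborel (\<lambda>r. ennreal (sphere_area DIM('a) * r ^ (DIM('a) - 1)) * indicator {a<..b} r)"
  \<comment> \<open>the cut-off keeps the inner radius between \<open>a\<close> and \<open>b\<close> when \<open>t\<close> lies outside that interval\<close>
  have \<mu>: "emeasure \<mu> {t<..} = ennreal (unit_ball_vol DIM('a) * (b ^ DIM('a) - (min b (max a t)) ^ DIM('a)))" for t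
  proof -
    have "emeasure \<mu> {t<..} = (\<integral>\<^sup>+(x::'a). indicator {a<..b} (norm x) * indicator (norm -` {t<..}) x \<partial>lborel)"
      using measurable_sets_borel[of "norm :: 'a \<Rightarrow> real" borel "{t<..}"]
      by (simp add: \<mu>_def emeasure_distr emeasure_density)
    also have "\<dots> = (\<integral>\<^sup>+(x::'a). indicator {x. min b (max a t) < norm x \<and> norm x \<le> b} x \<partial>lborel)"
      by (intro nn_integral_cong) (auto split: split_indicator)
    also have "\<dots> = emeasure lborel {x::'a. min b (max a t) < norm x \<and> norm x \<le> b}"
      by (rule nn_integral_indicator) simp
    finally show ?thesis
      using ab by (subst (asm) emeasure_shell) auto
  qed
  have \<nu>: "emeasure \<nu> {t<..} = ennreal (unit_ball_vol DIM('a) * (b ^ DIM('a) - (min b (max a t)) ^ DIM('a)))" for t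
  proof -
    have "emeasure \<nu> {t<..} = (\<integral>\<^sup>+r. ennreal (sphere_area DIM('a) * r ^ (DIM('a) - 1)) * indicator {min b (max a t)<..b} r \<partial>lborel)"
      unfolding \<nu>_def
      by (subst emeasure_density) (auto intro!: nn_integral_cong split: split_indicator)
    then show ?thesis
      using ab by (subst (asm) nn_integral_radial_weight) auto
  qed
  have "\<mu> = \<nu>"
    by (rule measure_eqI_lessThan) (auto simp: \<mu> \<nu>, simp_all add: \<mu>_def \<nu>_def)
  then have "integral\<^sup>N \<mu> f = integral\<^sup>N \<nu> f"
    by simp
  then show ?thesis
    by (simp add: \<mu>_def \<nu>_def nn_integral_distr nn_integral_density mult.commute)
qed

text \<open>Every shell used later has outer radius twice the inner one. The factor \<open>1 - 2 powr - \<alpha>\<close> that this produces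
is the one inside the constants \<open>\<kappa>\<^sub>\<alpha>\<close> and \<open>\<delta>\<^sub>\<alpha>\<close>.\<close>

lemma nn_integral_power_law_shell:
  fixes a \<alpha> :: real
  assumes "0 < a" "0 < \<alpha>"
  shows "(\<integral>\<^sup>+x. ennreal (norm x powr - (real DIM('a) + \<alpha>)) * indicator {a<..2 * a} (norm x)
            \<partial>(lborel :: 'a::euclidean_space measure))
       = ennreal (sphere_area DIM('a) / \<alpha> * (1 - 2 powr - \<alpha>) * a powr - \<alpha>)"
proof -
  let ?d = "DIM('a)" and ?s = "sphere_area DIM('a)"
  have s: "0 < ?s" by (simp add: sphere_area_pos)
  have "(\<integral>\<^sup>+x. ennreal (norm x powr - (real ?d + \<alpha>)) * indicator {a<..2 * a} (norm x) \<partial>(lborel :: 'a measure))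
      = (\<integral>\<^sup>+r. ennreal (r powr - (real ?d + \<alpha>)) * (ennreal (?s * r ^ (?d - 1)) * indicator {a<..2 * a} r) \<partial>lborel)"
    using assms by (intro nn_integral_radial_shell) auto
  also have "\<dots> = (\<integral>\<^sup>+r. ennreal (?s * r powr (- \<alpha> - 1)) * indicator {a..2 * a} r \<partial>lborel)"
  proof (intro nn_integral_cong_AE, use AE_lborel_singleton[of a] in eventually_elim)
    fix r :: real assume "r \<noteq> a"
    show "ennreal (r powr - (real ?d + \<alpha>)) * (ennreal (?s * r ^ (?d - 1)) * indicator {a<..2 * a} r)
        = ennreal (?s * r powr (- \<alpha> - 1)) * indicator {a..2 * a} r"
    proof (cases "r \<in> {a<..2 * a}")
      case True
      then have r: "0 < r" using assms by auto
      have "r powr - (real ?d + \<alpha>) * r ^ (?d - 1) = r powr (- \<alpha> - 1)"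
        using r DIM_positive[where 'a='a] unfolding powr_realpow[OF r, symmetric] powr_add[symmetric]
        by (simp add: of_nat_diff Suc_le_eq)
      then show ?thesis
        using True r s by (simp add: ennreal_mult'[symmetric] mult.left_commute)
    next
      case False
      then show ?thesis using \<open>r \<noteq> a\<close> by (auto split: split_indicator)
    qed
  qed
  also have "\<dots> = ennreal (- ?s / \<alpha> * (2 * a) powr - \<alpha> - - ?s / \<alpha> * a powr - \<alpha>)"
  proof (rule nn_integral_FTC_Icc)
    fix r :: real assume r: "r \<in> {a..2 * a}"
    show "((\<lambda>r. - ?s / \<alpha> * r powr - \<alpha>) has_real_derivative ?s * r powr (- \<alpha> - 1)) (at r)"
      using assms r by (auto intro!: derivative_eq_intros simp: field_simps powr_diff)
    show "0 \<le> ?s * r powr (- \<alpha> - 1)" using s by simp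
  qed (use assms in auto)
  also have "- ?s / \<alpha> * (2 * a) powr - \<alpha> - - ?s / \<alpha> * a powr - \<alpha> = ?s / \<alpha> * (1 - 2 powr - \<alpha>) * a powr - \<alpha>"
    using assms by (simp add: powr_mult field_simps)
  finally show ?thesis .
qed


section \<open>Explosive growth of a single trajectory\<close>

text \<open>Once \<open>norm (y k) \<ge> exp L\<close>, the drift factor \<open>\<eta> * ln (1 + norm (y k))\<close> is at least
\<open>\<eta> * L \<ge> 2 * (exp \<gamma> + c)\<close>. The step overshoots the origin: it multiplies the norm by at least
\<open>2 * exp \<gamma> + 2 * c - 1 \<ge> exp \<gamma> + 2 * c\<close>, and noise of size \<open>c\<close> cannot undo more than the surplus
\<open>2 * c * norm (y k)\<close>, since \<open>norm (y k) \<ge> 1\<close>.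
The first noise vector has to bring the iterate to the level \<open>exp L\<close> despite the starting point, whose
contribution is at most \<open>exp L\<close>; this is why its norm is asked to exceed \<open>2 * exp L\<close>.\<close>

lemma superlinear_scheme_growth:
  fixes y \<xi> :: "nat \<Rightarrow> 'a::euclidean_space"
  assumes y: "\<And>k. y (Suc k) = y k - (\<eta> * ln (1 + norm (y k))) *\<^sub>R y k + \<xi> (Suc k)"
    and \<eta>: "0 \<le> \<eta>" "\<eta> \<le> 1" and "0 \<le> L" "0 \<le> \<gamma>" "0 \<le> c"
    and L: "2 * (exp \<gamma> + c) \<le> \<eta> * L"
    and y0: "norm (y 0) * (1 + ln (1 + norm (y 0))) \<le> exp L"
    and \<xi>1: "2 * exp L \<le> norm (\<xi> 1)"
    and \<xi>: "\<And>k. 2 \<le> k \<Longrightarrow> k \<le> n \<Longrightarrow> norm (\<xi> k) \<le> c"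
    and k: "1 \<le> k" "k \<le> n"
  shows "exp (L + (real k - 1) * \<gamma>) \<le> norm (y k)"
  using k
proof (induction k rule: dec_induct)
  case base
  define l where "l = ln (1 + norm (y 0))"
  have l: "0 \<le> l" by (simp add: l_def)
  have "y 1 = \<xi> 1 + (1 - \<eta> * l) *\<^sub>R y 0"
    using y[of 0] by (simp add: l_def algebra_simps)
  then have "norm (\<xi> 1) - norm ((1 - \<eta> * l) *\<^sub>R y 0) \<le> norm (y 1)"
    by (metis norm_diff_ineq)
  moreover have "\<bar>1 - \<eta> * l\<bar> \<le> 1 + l"
    using l mult_nonneg_nonneg[OF \<eta>(1) l] mult_right_mono[OF \<eta>(2) l] by linarith
  then have "norm ((1 - \<eta> * l) *\<^sub>R y 0) \<le> norm (y 0) * (1 + l)"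
    unfolding norm_scaleR real_norm_def by (subst mult.commute) (intro mult_left_mono norm_ge_zero)
  ultimately show ?case
    using y0 \<xi>1 by (simp add: l_def)
next
  case (step k)
  define r where "r = norm (y k)"
  define l where "l = ln (1 + r)"
  define g where "g = exp \<gamma>"
  have IH: "exp (L + (real k - 1) * \<gamma>) \<le> r"
    using step by (simp add: r_def)
  have "exp L \<le> exp (L + (real k - 1) * \<gamma>)"
    using step \<open>0 \<le> \<gamma>\<close> by simp
  then have rL: "exp L \<le> r" using IH by (rule order_trans)
  then have r1: "1 \<le> r" using \<open>0 \<le> L\<close> by (meson one_le_exp_iff order_trans)
  have "L \<le> l"
    using rL r1 unfolding l_def by (subst ln_ge_iff) auto
  then have drift: "2 * (g + c) \<le> \<eta> * l"
    using L \<eta> mult_left_mono[of L l \<eta>] unfolding g_def by linarith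
  have g1: "1 \<le> g" using \<open>0 \<le> \<gamma>\<close> by (simp add: g_def)
  have "y (Suc k) = (1 - \<eta> * l) *\<^sub>R y k + \<xi> (Suc k)"
    using y[of k] by (simp add: l_def r_def algebra_simps)
  then have "norm ((1 - \<eta> * l) *\<^sub>R y k) - norm (\<xi> (Suc k)) \<le> norm (y (Suc k))"
    by (metis norm_diff_ineq)
  moreover have "1 \<le> \<eta> * l"
    using drift g1 \<open>0 \<le> c\<close> by argo
  then have "\<bar>1 - \<eta> * l\<bar> = \<eta> * l - 1"
    by simp
  then have "norm ((1 - \<eta> * l) *\<^sub>R y k) = (\<eta> * l - 1) * r"
    by (simp add: r_def)
  moreover have "norm (\<xi> (Suc k)) \<le> c"
    using \<xi>[of "Suc k"] step by simp
  moreover have "(g + 2 * c) * r \<le> (\<eta> * l - 1) * r"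
    using drift g1 r1 by (intro mult_right_mono) auto
  moreover have "c \<le> 2 * c * r"
    using \<open>0 \<le> c\<close> r1 mult_left_mono[of 1 r c] by simp
  ultimately have "g * r \<le> norm (y (Suc k))"
    by (simp add: algebra_simps)
  moreover have "exp (L + (real (Suc k) - 1) * \<gamma>) \<le> g * r"
    using mult_left_mono[OF IH, of g] by (simp add: g_def exp_add[symmetric] algebra_simps)
  ultimately show ?case by linarith
qed

section \<open>Events of one large and many small noise vectors\<close>

lemma (in prob_space) prob_first_large_rest_small:
  fixes \<xi> :: "nat \<Rightarrow> 'a \<Rightarrow> 'b::euclidean_space"
  assumes ind: "indep_vars (\<lambda>_. borel) \<xi> {1..n}" and n: "1 \<le> n" and "0 \<le> q"
    and large: "q \<le> prob {\<omega> \<in> space M. R \<le> norm (\<xi> 1 \<omega>)}"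
    and "0 \<le> s"
    and small: "\<And>k. 2 \<le> k \<Longrightarrow> k \<le> n \<Longrightarrow> s \<le> prob {\<omega> \<in> space M. norm (\<xi> k \<omega>) \<le> c}"
  shows "q * s ^ (n - 1)
       \<le> prob {\<omega> \<in> space M. R \<le> norm (\<xi> 1 \<omega>) \<and> (\<forall>k\<in>{2..n}. norm (\<xi> k \<omega>) \<le> c)}"
proof -
  define A where "A = (\<lambda>k::nat. if k = 1 then {x::'b. R \<le> norm x} else {x. norm x \<le> c})"
  have [measurable]: "A k \<in> sets borel" for k
    by (auto simp: A_def)
  have split: "{1..n} = insert 1 {2..n}" using n by auto
  have "q * s ^ (n - 1) = q * (\<Prod>k\<in>{2..n}. s)"
    by simp
  also have "\<dots> \<le> prob {\<omega> \<in> space M. R \<le> norm (\<xi> 1 \<omega>)} * (\<Prod>k\<in>{2..n}. prob {\<omega> \<in> space M. norm (\<xi> k \<omega>) \<le> c})"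
    using assms by (intro mult_mono prod_mono prod_nonneg) auto
  also have "\<dots> = (\<Prod>k\<in>{1..n}. prob (\<xi> k -` A k \<inter> space M))"
    unfolding split
    by (subst prod.insert) (auto simp: A_def vimage_def Int_def conj_commute intro!: prod.cong)
  also have "\<dots> = prob (\<Inter>k\<in>{1..n}. \<xi> k -` A k \<inter> space M)"
    using n by (intro indep_varsD[OF ind, symmetric]) auto
  also have "(\<Inter>k\<in>{1..n}. \<xi> k -` A k \<inter> space M)
     = {\<omega> \<in> space M. R \<le> norm (\<xi> 1 \<omega>) \<and> (\<forall>k\<in>{2..n}. norm (\<xi> k \<omega>) \<le> c)}"
    unfolding split by (auto simp: A_def)
  finally show ?thesis .
qed

lemma exp_over_linear_at_top:
  fixes c \<rho> :: real
  assumes "0 < c" "0 < \<rho>"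
  shows "filterlim (\<lambda>n. c / real n * exp (real n * \<rho>)) at_top sequentially"
  using assms by real_asymp

text \<open>The conclusion shared by both schemes: \<open>Y n\<close> is the last iterate of the scheme with \<open>n\<close> steps, and
\<open>\<gamma>\<close> stands for \<open>\<delta>\<^sub>\<alpha>\<close> or \<open>\<kappa>\<^sub>\<alpha>\<close>.\<close>

definition explodes ::
    "'w measure \<Rightarrow> real \<Rightarrow> real \<Rightarrow> real \<Rightarrow> 'a::euclidean_space \<Rightarrow> real \<Rightarrow> real \<Rightarrow> (nat \<Rightarrow> 'w \<Rightarrow> 'a) \<Rightarrow> bool" where
  "explodes M \<alpha> \<beta> T x0 K \<gamma> Y \<longleftrightarrow>
     (\<exists>C>0. \<exists>\<Omega> :: nat \<Rightarrow> 'w set.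
        (\<forall>n. \<Omega> n \<in> sets M \<and> \<Omega> n \<noteq> {}) \<and>
        (\<forall>n\<ge>1. T / real n \<le> 1 \<longrightarrow>
           exp (real n * K) \<ge> norm x0 * (1 + ln (1 + norm x0)) \<longrightarrow>
           measure M (\<Omega> n) \<ge> C * exp (- \<alpha> * real n * K) / (real n * \<gamma> ^ n) \<and>
           (\<forall>\<omega>\<in>\<Omega> n. norm (Y n \<omega>) \<ge> exp (real n * K + (real n - 1) * (\<gamma> / \<beta>))))) \<and>
     ((\<lambda>n. \<integral>\<^sup>+\<omega>. ennreal (norm (Y n \<omega>) powr \<beta>) \<partial>M) \<longlonglongrightarrow> \<infinity>)"

text \<open>The event is that the first noise vector exceeds \<open>2 * exp (n * K)\<close> and the others stay below \<open>c\<close>.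
Its probability is at least \<open>C * exp (- \<alpha> * n * K) / n\<close> times \<open>(1 / \<delta>) ^ (n - 1)\<close>, and on it the growth lemma
applies with \<open>L = n * K\<close>: the factor \<open>n\<close> in \<open>L\<close> cancels against the step size \<open>T / n\<close>, and \<open>T * K = 2 * (exp (\<delta> / \<beta>) + c)\<close>
is exactly what that lemma asks for. For the moment, multiplying the probability by the \<open>\<beta>\<close>-th power of the lower
bound leaves a constant times \<open>exp (n * (\<delta> - ln \<delta> - (\<alpha> - \<beta>) * K)) / n\<close>, whose exponent is positive by the
bound on \<open>K\<close>.\<close>

lemma (in prob_space) superlinear_scheme_moment_explosion:
  fixes Y \<xi> :: "nat \<Rightarrow> nat \<Rightarrow> 'a \<Rightarrow> 'b::euclidean_space" and x0 :: 'b
  assumes par: "0 < \<beta>" "\<beta> < \<alpha>" "0 < T" "0 \<le> c" "1 \<le> \<delta>" "0 < C"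
    and K_def: "K = 2 * (exp (\<delta> / \<beta>) + c) / T"
    and K: "K < (\<delta> - ln \<delta>) / (\<alpha> - \<beta>)"
    and Y0: "\<And>n \<omega>. Y n 0 \<omega> = x0"
    and YS: "\<And>n k \<omega>. Y n (Suc k) \<omega>
        = Y n k \<omega> - (T / real n * ln (1 + norm (Y n k \<omega>))) *\<^sub>R Y n k \<omega> + \<xi> n (Suc k) \<omega>"
    and ind: "\<And>n. 1 \<le> n \<Longrightarrow> indep_vars (\<lambda>_. borel) (\<xi> n) {1..n}"
    and large: "\<And>n. 1 \<le> n \<Longrightarrow> T / real n \<le> 1 \<Longrightarrow>
        C * exp (- \<alpha> * real n * K) / real n \<le> prob {\<omega> \<in> space M. 2 * exp (real n * K) \<le> norm (\<xi> n 1 \<omega>)}"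
    and small: "\<And>n k. 2 \<le> k \<Longrightarrow> k \<le> n \<Longrightarrow> T / real n \<le> 1 \<Longrightarrow>
        1 / \<delta> \<le> prob {\<omega> \<in> space M. norm (\<xi> n k \<omega>) \<le> c}"
  shows "explodes M \<alpha> \<beta> T x0 K \<delta> (\<lambda>n. Y n n)"
proof -
  define E where "E n = {\<omega> \<in> space M. 2 * exp (real n * K) \<le> norm (\<xi> n 1 \<omega>)
                    \<and> (\<forall>k\<in>{2..n}. norm (\<xi> n k \<omega>) \<le> c)}" for n
  define good where "good n \<longleftrightarrow> 1 \<le> n \<and> T / real n \<le> 1
                    \<and> norm x0 * (1 + ln (1 + norm x0)) \<le> exp (real n * K)" for n
  \<comment> \<open>the whole space serves as a non-empty filler for those \<open>n\<close> about which nothing is claimed\<close>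
  define \<Omega> where "\<Omega> n = (if good n then E n else space M)" for n
  have "0 < K" unfolding K_def using par by (intro divide_pos_pos) (auto intro: add_pos_nonneg)
  have E_prob: "C * exp (- \<alpha> * real n * K) / (real n * \<delta> ^ n) \<le> prob (E n)" if "good n" for n
  proof -
    have n: "1 \<le> n" "T / real n \<le> 1" using that by (auto simp: good_def)
    have "C * exp (- \<alpha> * real n * K) / (real n * \<delta> ^ n) = C * exp (- \<alpha> * real n * K) / real n * (1 / \<delta>) ^ n"
      by (simp add: power_divide)
    also have "\<dots> \<le> C * exp (- \<alpha> * real n * K) / real n * (1 / \<delta>) ^ (n - 1)"
      using par by (intro mult_left_mono power_decreasing) auto
    also have "\<dots> \<le> prob (E n)"
      unfolding E_def using par n
      by (intro prob_first_large_rest_small ind large small) auto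
    finally show ?thesis .
  qed
  have E_sets: "E n \<in> sets M" if "good n" for n
  proof -
    have n: "1 \<le> n" using that by (simp add: good_def)
    have [measurable]: "\<xi> n k \<in> borel_measurable M" if "k \<in> {1..n}" for k
      using ind[OF n] that by (auto simp: indep_vars_def)
    have [measurable]: "\<xi> n (Suc 0) \<in> borel_measurable M"
      using n by simp
    have "{\<omega> \<in> space M. \<forall>k\<in>{2..n}. norm (\<xi> n k \<omega>) \<le> c} \<in> sets M"
      by (intro sets.sets_Collect_finite_All) auto
    then show ?thesis unfolding E_def by (intro sets.sets_Collect_conj) auto
  qed
  have E_ne: "E n \<noteq> {}" if "good n" for n
  proof -
    have "0 < C * exp (- \<alpha> * real n * K) / (real n * \<delta> ^ n)"
      using that par by (simp add: good_def)
    then show ?thesis using E_prob[OF that] by auto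
  qed
  have E_growth: "exp (real n * K + (real n - 1) * (\<delta> / \<beta>)) \<le> norm (Y n n \<omega>)"
    if "good n" "\<omega> \<in> E n" for n \<omega>
  proof (rule superlinear_scheme_growth[where y = "\<lambda>k. Y n k \<omega>" and \<xi> = "\<lambda>k. \<xi> n k \<omega>" and \<eta> = "T / real n" and c = c and n = n])
    show "2 * (exp (\<delta> / \<beta>) + c) \<le> T / real n * (real n * K)"
      using par that by (simp add: K_def good_def)
    show "norm (Y n 0 \<omega>) * (1 + ln (1 + norm (Y n 0 \<omega>))) \<le> exp (real n * K)"
      using that by (simp add: Y0 good_def)
  qed (use that par \<open>0 < K\<close> in \<open>auto simp: YS good_def E_def\<close>)
  have moment: "ennreal (C * exp (- \<delta>) / real n * exp (real n * (\<delta> - ln \<delta> - (\<alpha> - \<beta>) * K)))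
      \<le> (\<integral>\<^sup>+\<omega>. ennreal (norm (Y n n \<omega>) powr \<beta>) \<partial>M)" if "good n" for n
  proof -
    let ?m = "exp (real n * K + (real n - 1) * (\<delta> / \<beta>)) powr \<beta>"
    have "?m = exp (\<beta> * real n * K + (real n - 1) * \<delta>)"
      using par by (simp add: powr_def field_simps)
    moreover have "\<delta> ^ n = exp (real n * ln \<delta>)"
      using par by (simp add: exp_of_nat_mult)
    ultimately have "C * exp (- \<delta>) / real n * exp (real n * (\<delta> - ln \<delta> - (\<alpha> - \<beta>) * K))
        = ?m * (C * exp (- \<alpha> * real n * K) / (real n * \<delta> ^ n))"
      by (simp add: divide_inverse exp_minus[symmetric] mult_ac exp_add[symmetric])
        (simp add: algebra_simps)
    also have "\<dots> \<le> ?m * prob (E n)"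
      by (intro mult_left_mono E_prob that) auto
    finally have "ennreal (C * exp (- \<delta>) / real n * exp (real n * (\<delta> - ln \<delta> - (\<alpha> - \<beta>) * K)))
        \<le> ennreal ?m * emeasure M (E n)"
      by (simp add: emeasure_eq_measure ennreal_mult'[symmetric] ennreal_leI)
    also have "\<dots> = (\<integral>\<^sup>+\<omega>. ennreal ?m * indicator (E n) \<omega> \<partial>M)"
      using E_sets[OF that] by (simp add: nn_integral_cmult_indicator)
    also have "\<dots> \<le> (\<integral>\<^sup>+\<omega>. ennreal (norm (Y n n \<omega>) powr \<beta>) \<partial>M)"
      using E_growth[OF that] par
      by (intro nn_integral_mono) (auto split: split_indicator intro!: ennreal_leI powr_mono2)
    finally show ?thesis .
  qed
  have "\<forall>\<^sub>F n in sequentially. T / real n \<le> 1"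
    using par by real_asymp
  moreover have "\<forall>\<^sub>F n in sequentially. norm x0 * (1 + ln (1 + norm x0)) \<le> exp (real n * K)"
    using \<open>0 < K\<close> by real_asymp
  ultimately have ev: "\<forall>\<^sub>F n in sequentially. good n"
    using eventually_ge_at_top[of 1] by eventually_elim (simp add: good_def)
  have "0 < \<delta> - ln \<delta> - (\<alpha> - \<beta>) * K"
    using K par by (simp add: field_simps)
  then have "filterlim (\<lambda>n. C * exp (- \<delta>) / real n * exp (real n * (\<delta> - ln \<delta> - (\<alpha> - \<beta>) * K))) at_top sequentially"
    using par by (intro exp_over_linear_at_top) auto
  then have "(\<lambda>n. ennreal (C * exp (- \<delta>) / real n * exp (real n * (\<delta> - ln \<delta> - (\<alpha> - \<beta>) * K)))) \<longlonglongrightarrow> \<infinity>"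
    by (simp add: ennreal_tendsto_top_eq_at_top)
  then have lim: "(\<lambda>n. \<integral>\<^sup>+\<omega>. ennreal (norm (Y n n \<omega>) powr \<beta>) \<partial>M) \<longlonglongrightarrow> \<infinity>"
    by (rule tendsto_sandwich[rotated 2, OF _ tendsto_const])
      (use ev moment in \<open>auto elim: eventually_mono\<close>)
  have "(\<forall>n. \<Omega> n \<in> sets M \<and> \<Omega> n \<noteq> {})"
    using E_sets E_ne not_empty by (auto simp: \<Omega>_def)
  moreover have "(\<forall>n\<ge>1. T / real n \<le> 1 \<longrightarrow>
                 exp (real n * K) \<ge> norm x0 * (1 + ln (1 + norm x0)) \<longrightarrow>
                 measure M (\<Omega> n) \<ge> C * exp (- \<alpha> * real n * K) / (real n * \<delta> ^ n) \<and>
                 (\<forall>\<omega>\<in>\<Omega> n. norm (Y n n \<omega>) \<ge> exp (real n * K + (real n - 1) * (\<delta> / \<beta>))))"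
    using E_prob E_growth by (auto simp: \<Omega>_def good_def)
  ultimately show ?thesis
    unfolding explodes_def using lim \<open>0 < C\<close> by blast
qed


section \<open>Power-law lower bounds for shell probabilities\<close>

lemma (in prob_space) prob_dyadic_shell_ge:
  fixes X :: "'a \<Rightarrow> 'b::euclidean_space"
  assumes X: "distributed M lborel X (\<lambda>x. ennreal (q x))"
    and q: "\<And>x. a < norm x \<Longrightarrow> norm x \<le> 2 * a \<Longrightarrow> c * norm x powr - (real DIM('b) + \<alpha>) \<le> q x"
    and "0 \<le> c" "0 < a" "0 < \<alpha>"
  shows "c * (sphere_area DIM('b) / \<alpha> * (1 - 2 powr - \<alpha>) * a powr - \<alpha>)
       \<le> prob {\<omega> \<in> space M. a < norm (X \<omega>) \<and> norm (X \<omega>) \<le> 2 * a}"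
proof -
  let ?S = "{x::'b. a < norm x \<and> norm x \<le> 2 * a}"
  have "ennreal (c * (sphere_area DIM('b) / \<alpha> * (1 - 2 powr - \<alpha>) * a powr - \<alpha>))
      = (\<integral>\<^sup>+x. ennreal c * (ennreal (norm x powr - (real DIM('b) + \<alpha>)) * indicator {a<..2 * a} (norm x)) \<partial>(lborel :: 'b measure))"
    using assms by (subst nn_integral_cmult) (auto simp: nn_integral_power_law_shell ennreal_mult'[symmetric] simp del: minus_add_distrib)
  also have "\<dots> \<le> (\<integral>\<^sup>+x. ennreal (q x) * indicator ?S x \<partial>lborel)"
    using q \<open>0 \<le> c\<close>
    by (intro nn_integral_mono) (auto split: split_indicator simp: ennreal_mult'[symmetric] intro!: ennreal_leI)
  also have "\<dots> = emeasure M (X -` ?S \<inter> space M)"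
    by (rule distributed_emeasure[OF X, symmetric]) simp
  also have "X -` ?S \<inter> space M = {\<omega> \<in> space M. a < norm (X \<omega>) \<and> norm (X \<omega>) \<le> 2 * a}"
    by auto
  finally show ?thesis
    by (simp add: emeasure_eq_measure)
qed

text \<open>Outside the radius \<open>t powr (1 / \<alpha>)\<close> the sum \<open>t powr (1 / \<alpha>) + norm x\<close> is at most \<open>2 * norm x\<close>, so the lower
heat kernel bound dominates a pure power law. The bound serves at two scales: at \<open>a = t powr (1 / \<alpha>)\<close>
it reads \<open>1 / \<delta>\<close>, with no dependence on \<open>t\<close>, and at large \<open>a\<close> it is the heavy tail.\<close>

lemma (in prob_space) prob_dyadic_shell_heat_kernel:
  fixes X :: "'a \<Rightarrow> 'b::euclidean_space"
  assumes X: "distributed M lborel X (\<lambda>x. ennreal (p t x))"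
    and p: "heat_kernel_bounds \<alpha> K p"
    and "0 < t" "0 < \<alpha>" "1 \<le> K" and a: "t powr (1 / \<alpha>) \<le> a"
  shows "t * a powr - \<alpha> / delta_const DIM('b) \<alpha> K
       \<le> prob {\<omega> \<in> space M. a < norm (X \<omega>) \<and> norm (X \<omega>) \<le> 2 * a}"
proof -
  let ?d = "real DIM('b)"
  have "0 < t powr (1 / \<alpha>)" using \<open>0 < t\<close> by simp
  then have "0 < a" using a by linarith
  have "t / K * 2 powr - (?d + \<alpha>) * norm x powr - (?d + \<alpha>) \<le> p t x" if x: "a < norm x" for x
  proof -
    have "t / K * 2 powr - (?d + \<alpha>) * norm x powr - (?d + \<alpha>) = inverse K * (t / (2 * norm x) powr (?d + \<alpha>))"
      by (simp add: powr_mult powr_minus divide_inverse del: minus_add_distrib)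
    also have "\<dots> \<le> inverse K * (t / (t powr (1 / \<alpha>) + norm x) powr (?d + \<alpha>))"
    proof -
      have "0 < t powr (1 / \<alpha>) + norm x" "t powr (1 / \<alpha>) + norm x \<le> 2 * norm x"
        using a x \<open>0 < t powr (1 / \<alpha>)\<close> by linarith+
      then show ?thesis
        using assms by (intro mult_left_mono divide_left_mono powr_mono2 mult_pos_pos) auto
    qed
    also have "\<dots> \<le> p t x"
      using p \<open>0 < t\<close> by (simp add: heat_kernel_bounds_def)
    finally show ?thesis .
  qed
  then have "t / K * 2 powr - (?d + \<alpha>) * (sphere_area DIM('b) / \<alpha> * (1 - 2 powr - \<alpha>) * a powr - \<alpha>)
      \<le> prob {\<omega> \<in> space M. a < norm (X \<omega>) \<and> norm (X \<omega>) \<le> 2 * a}"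
    using assms \<open>0 < a\<close> by (intro prob_dyadic_shell_ge[OF X]) auto
  also have "t / K * 2 powr - (?d + \<alpha>) * (sphere_area DIM('b) / \<alpha> * (1 - 2 powr - \<alpha>) * a powr - \<alpha>)
      = t * a powr - \<alpha> / delta_const DIM('b) \<alpha> K"
    by (simp add: delta_const_def powr_minus divide_inverse mult_ac del: minus_add_distrib)
  finally show ?thesis .
qed

text \<open>Again used at two scales: \<open>a = 1\<close> gives \<open>1 / \<kappa>\<close>, and large \<open>a\<close> gives the heavy tail.\<close>

lemma (in prob_space) prob_dyadic_shell_pareto:
  fixes X :: "'a \<Rightarrow> 'b::euclidean_space"
  assumes X: "distributed M lborel X (\<lambda>x. ennreal (pareto_density \<alpha> x))"
    and "0 < \<alpha>" "1 \<le> a"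
  shows "a powr - \<alpha> / kappa_const \<alpha> \<le> prob {\<omega> \<in> space M. a < norm (X \<omega>) \<and> norm (X \<omega>) \<le> 2 * a}"
proof -
  have s: "0 < sphere_area DIM('b)" by (simp add: sphere_area_pos)
  have "\<alpha> / sphere_area DIM('b) * (sphere_area DIM('b) / \<alpha> * (1 - 2 powr - \<alpha>) * a powr - \<alpha>)
      \<le> prob {\<omega> \<in> space M. a < norm (X \<omega>) \<and> norm (X \<omega>) \<le> 2 * a}"
  proof (rule prob_dyadic_shell_ge[OF X])
    fix x :: 'b assume "a < norm x"
    then show "\<alpha> / sphere_area DIM('b) * norm x powr - (real DIM('b) + \<alpha>) \<le> pareto_density \<alpha> x"
      using \<open>1 \<le> a\<close> unfolding powr_minus by (simp add: pareto_density_def divide_inverse add.commute)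
  qed (use assms s in auto)
  moreover have "1 - 2 powr - \<alpha> = 1 / kappa_const \<alpha>"
    by (simp add: kappa_const_def powr_minus field_simps)
  ultimately show ?thesis
    using s \<open>0 < \<alpha>\<close> by simp
qed

section \<open>The constants\<close>

lemma kappa_const_ge_1: "0 < \<alpha> \<Longrightarrow> 1 \<le> kappa_const \<alpha>"
  by (simp add: kappa_const_def)

lemma delta_const_pos:
  assumes "0 < d" "0 < \<alpha>" "1 \<le> K"
  shows "0 < delta_const d \<alpha> K"
proof -
  have "2 powr - \<alpha> < (1::real)" using \<open>0 < \<alpha>\<close> by (simp add: powr_less_one)
  then show ?thesis
    using assms sphere_area_pos[of d] by (simp add: delta_const_def)
qed

lemma sigma_const_pos:
  assumes "0 < d" "0 < \<alpha>" "\<alpha> < 2"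
  shows "0 < sigma_const d \<alpha>"
proof -
  have "0 < levy_const d \<alpha>"
    using assms unfolding levy_const_def
    by (intro divide_pos_pos mult_pos_pos Gamma_real_pos) auto
  then show ?thesis
    using assms sphere_area_pos[of d] by (simp add: sigma_const_def)
qed

section \<open>The scheme driven by a stable process\<close>

lemma (in prob_space) stable_increment_distributed:
  fixes Z :: "real \<Rightarrow> 'a \<Rightarrow> 'b::euclidean_space"
  assumes "levy_process M Z" "transition_density M Z p" "0 \<le> s" "0 < t"
  shows "distributed M lborel (\<lambda>\<omega>. Z (s + t) \<omega> - Z s \<omega>) (\<lambda>x. ennreal (p t x))"
proof -
  have [measurable]: "Z s \<in> borel_measurable M" "Z (s + t) \<in> borel_measurable M"
    and st: "distr M borel (\<lambda>\<omega>. Z (s + t) \<omega> - Z s \<omega>) = distr M borel (Z t)"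
    using assms by (auto simp: levy_process_def)
  have Zt: "distributed M lborel (Z t) (\<lambda>x. ennreal (p t x))"
    using assms by (simp add: transition_density_def)
  have "distr M lborel (\<lambda>\<omega>. Z (s + t) \<omega> - Z s \<omega>) = distr M borel (\<lambda>\<omega>. Z (s + t) \<omega> - Z s \<omega>)"
    by (rule distr_cong) auto
  also have "\<dots> = distr M lborel (Z t)"
    unfolding st by (rule distr_cong) auto
  finally show ?thesis
    using Zt by (auto simp: distributed_def)
qed

lemma (in prob_space) levy_grid_increments_indep:
  fixes Z :: "real \<Rightarrow> 'a \<Rightarrow> 'b::euclidean_space"
  assumes "levy_process M Z" "0 \<le> \<eta>"
  shows "indep_vars (\<lambda>_. borel) (\<lambda>k \<omega>. Z (real k * \<eta>) \<omega> - Z (real (k - 1) * \<eta>) \<omega>) {1..n}"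
proof -
  \<comment> \<open>truncated subtraction makes the increment with index 0 vanish, so that those with indices \<open>1..n\<close> are the ones of interest\<close>
  define t where "t k = real (k - 1) * \<eta>" for k
  have "mono t"
    using \<open>0 \<le> \<eta>\<close> by (auto intro!: monoI mult_right_mono simp: t_def)
  moreover have "0 \<le> t 0"
    by (simp add: t_def)
  ultimately have "indep_vars (\<lambda>_. borel) (\<lambda>i \<omega>. Z (t (Suc i)) \<omega> - Z (t i) \<omega>) {..<Suc n}"
    using assms(1) unfolding levy_process_def by blast
  then have "indep_vars (\<lambda>_. borel) (\<lambda>i \<omega>. Z (t (Suc i)) \<omega> - Z (t i) \<omega>) {1..n}"
    by (rule indep_vars_subset) auto
  then show ?thesis
    by (simp add: t_def)
qed

text \<open>With step size at most 1, each increment has norm at most 2 with probability at least \<open>1 / \<delta>\<close>, because the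
shell at their natural scale \<open>(T / n) powr (1 / \<alpha>)\<close> lies in that ball.\<close>

lemma (in prob_space) stable_scheme_explosion:
  fixes Z :: "real \<Rightarrow> 'a \<Rightarrow> 'b::euclidean_space" and x0 :: 'b
  assumes par: "0 < \<beta>" "\<beta> < \<alpha>" "0 < T" "1 \<le> K"
    and Z: "levy_process M Z" "transition_density M Z p"
    and p: "heat_kernel_bounds \<alpha> K p"
    and \<delta>_def: "\<delta> = delta_const DIM('b) \<alpha> K" and K1_def: "K1 = K1_const DIM('b) \<alpha> \<beta> K T"
    and K1: "K1 < (\<delta> - ln \<delta>) / (\<alpha> - \<beta>)"
  shows "explodes M \<alpha> \<beta> T x0 K1 \<delta> (\<lambda>n. stable_scheme (T / real n) x0 Z n)"
proof -
  have \<alpha>: "0 < \<alpha>" using par by linarith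
  define \<xi> where "\<xi> n k \<omega> = Z (real k * (T / real n)) \<omega> - Z (real (k - 1) * (T / real n)) \<omega>" for n k \<omega>
  have K1_eq: "K1 = 2 * (exp (\<delta> / \<beta>) + 2) / T"
    by (simp add: K1_def K1_const_def \<delta>_def)
  have "0 < K1" unfolding K1_eq using par by (intro divide_pos_pos) (auto intro: add_pos_pos)
  have \<delta>0: "0 < \<delta>" unfolding \<delta>_def using par \<alpha> by (intro delta_const_pos) auto
  have \<xi>: "distributed M lborel (\<xi> n k) (\<lambda>x. ennreal (p (T / real n) x))" if "1 \<le> n" "1 \<le> k" for n k
  proof -
    have "real k * (T / real n) = real (k - 1) * (T / real n) + T / real n"
      using that by (simp add: of_nat_diff left_diff_distrib diff_divide_distrib)
    then show ?thesis
      using stable_increment_distributed[OF Z, of "real (k - 1) * (T / real n)" "T / real n"] par that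
      unfolding \<xi>_def by simp
  qed
  note shell = prob_dyadic_shell_heat_kernel[OF \<xi> p _ \<alpha> \<open>1 \<le> K\<close>, folded \<delta>_def]
  have meas [measurable]: "\<xi> n k \<in> borel_measurable M" if "1 \<le> n" "1 \<le> k" for n k
    using \<xi>[OF that] by (auto simp: distributed_def)
  have small: "1 / \<delta> \<le> prob {\<omega> \<in> space M. norm (\<xi> n k \<omega>) \<le> 2}"
    if "1 \<le> n" "1 \<le> k" "T / real n \<le> 1" for n k
  proof -
    let ?a = "(T / real n) powr (1 / \<alpha>)"
    have "?a \<le> 1" using that par \<alpha> by (simp add: powr_le1)
    have "1 / \<delta> = T / real n * ?a powr - \<alpha> / \<delta>"
      using that par \<alpha> by (simp add: powr_powr powr_minus)
    also have "\<dots> \<le> prob {\<omega> \<in> space M. ?a < norm (\<xi> n k \<omega>) \<and> norm (\<xi> n k \<omega>) \<le> 2 * ?a}"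
      using that par by (intro shell) auto
    also have "\<dots> \<le> prob {\<omega> \<in> space M. norm (\<xi> n k \<omega>) \<le> 2}"
      using meas[OF that(1,2)] \<open>?a \<le> 1\<close> by (intro finite_measure_mono) auto
    finally show ?thesis .
  qed
  \<comment> \<open>\<open>1 / \<delta>\<close> is a lower bound for a probability, provided some step size is admissible\<close>
  have "1 \<le> \<delta>"
  proof -
    define n where "n = nat \<lceil>max 1 T\<rceil>"
    have "max 1 T \<le> real n" unfolding n_def by (rule real_nat_ceiling_ge)
    then have "1 \<le> n" "T / real n \<le> 1" by auto
    then have "1 / \<delta> \<le> 1"
      using small[of n 1] prob_le_1 order_trans by blast
    then show ?thesis using \<delta>0 by simp
  qed
  have large: "T * 2 powr - \<alpha> / \<delta> * exp (- \<alpha> * real n * K1) / real n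
      \<le> prob {\<omega> \<in> space M. 2 * exp (real n * K1) \<le> norm (\<xi> n 1 \<omega>)}"
    if "1 \<le> n" "T / real n \<le> 1" for n
  proof -
    let ?a = "2 * exp (real n * K1)"
    have "(T / real n) powr (1 / \<alpha>) \<le> 1" using that par \<alpha> by (simp add: powr_le1)
    moreover have "1 \<le> exp (real n * K1)" using \<open>0 < K1\<close> by simp
    ultimately have a: "(T / real n) powr (1 / \<alpha>) \<le> ?a" by linarith
    have "T * 2 powr - \<alpha> / \<delta> * exp (- \<alpha> * real n * K1) / real n = T / real n * ?a powr - \<alpha> / \<delta>"
      by (simp add: powr_mult exp_powr_real mult_ac)
    also have "\<dots> \<le> prob {\<omega> \<in> space M. ?a < norm (\<xi> n 1 \<omega>) \<and> norm (\<xi> n 1 \<omega>) \<le> 2 * ?a}"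
      using that par a by (intro shell) auto
    also have "\<dots> \<le> prob {\<omega> \<in> space M. ?a \<le> norm (\<xi> n 1 \<omega>)}"
      using meas[of n 1] that by (intro finite_measure_mono) auto
    finally show ?thesis .
  qed
  show ?thesis
  proof (rule superlinear_scheme_moment_explosion[where Y = "\<lambda>n. stable_scheme (T / real n) x0 Z" and \<xi> = \<xi>
        and c = 2 and C = "T * 2 powr - \<alpha> / \<delta>"])
    show "indep_vars (\<lambda>_. borel) (\<xi> n) {1..n}" if "1 \<le> n" for n
      using levy_grid_increments_indep[OF Z(1), of "T / real n" n] par unfolding \<xi>_def by simp
  qed (use par K1 K1_eq \<open>1 \<le> \<delta>\<close> \<delta>0 large small in \<open>auto simp: \<xi>_def\<close>)
qed

section \<open>The scheme driven by Pareto vectors\<close>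

text \<open>The noise here is the Pareto vector times \<open>w n / \<sigma>\<close> with \<open>w n = (T / n) powr (1 / \<alpha>) \<le> 1\<close>, so a Pareto vector of norm
at most 2 gives noise of norm at most \<open>2 / \<sigma>\<close>, the constant that appears in \<open>K\<^sub>2\<close>. In the tail, scaling by
\<open>w n\<close> produces the factor \<open>w n powr \<alpha> = T / n\<close>.\<close>

lemma (in prob_space) pareto_scheme_explosion:
  fixes Z :: "nat \<Rightarrow> 'a \<Rightarrow> 'b::euclidean_space" and x0 :: 'b
  assumes par: "0 < \<beta>" "\<beta> < \<alpha>" "\<alpha> < 2" "0 < T"
    and Z: "iid_pareto M \<alpha> Z"
    and \<kappa>_def: "\<kappa> = kappa_const \<alpha>" and K2_def: "K2 = K2_const DIM('b) \<alpha> \<beta> T"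
    and K2: "K2 < (\<kappa> - ln \<kappa>) / (\<alpha> - \<beta>)"
  shows "explodes M \<alpha> \<beta> T x0 K2 \<kappa> (\<lambda>n. pareto_scheme \<alpha> (T / real n) x0 Z n)"
proof -
  have \<alpha>: "0 < \<alpha>" using par by linarith
  define \<sigma> where "\<sigma> = sigma_const DIM('b) \<alpha>"
  have \<sigma>: "0 < \<sigma>" unfolding \<sigma>_def using par \<alpha> by (intro sigma_const_pos) auto
  define w where "w n = (T / real n) powr (1 / \<alpha>)" for n
  define \<xi> where "\<xi> n k \<omega> = (1 / \<sigma> * w n) *\<^sub>R Z k \<omega>" for n k \<omega>
  have norm_\<xi>: "norm (\<xi> n k \<omega>) = w n * norm (Z k \<omega>) / \<sigma>" for n k \<omega>
    using \<sigma> by (simp add: \<xi>_def w_def)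
  have K2_eq: "K2 = 2 * (exp (\<kappa> / \<beta>) + 2 / \<sigma>) / T"
    by (simp add: K2_def K2_const_def \<kappa>_def \<sigma>_def)
  have "0 < K2" unfolding K2_eq using par \<sigma> by (intro divide_pos_pos) (auto intro: add_pos_pos)
  have "1 \<le> \<kappa>" unfolding \<kappa>_def using \<alpha> by (rule kappa_const_ge_1)
  have Zk: "distributed M lborel (Z k) (\<lambda>x. ennreal (pareto_density \<alpha> x))" if "1 \<le> k" for k
    using Z that by (simp add: iid_pareto_def)
  note shell = prob_dyadic_shell_pareto[OF Zk \<alpha>, folded \<kappa>_def]
  have meas [measurable]: "Z k \<in> borel_measurable M" if "1 \<le> k" for k
    using Zk[OF that] by (auto simp: distributed_def)
  have w: "0 < w n" "w n \<le> 1" if "1 \<le> n" "T / real n \<le> 1" for n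
    using that par \<alpha> by (auto simp: w_def powr_le1)
  have small: "1 / \<kappa> \<le> prob {\<omega> \<in> space M. norm (\<xi> n k \<omega>) \<le> 2 / \<sigma>}"
    if "1 \<le> n" "1 \<le> k" "T / real n \<le> 1" for n k
  proof -
    have "1 / \<kappa> = 1 powr - \<alpha> / \<kappa>" by simp
    also have "\<dots> \<le> prob {\<omega> \<in> space M. 1 < norm (Z k \<omega>) \<and> norm (Z k \<omega>) \<le> 2 * 1}"
      using that by (intro shell) auto
    also have "\<dots> \<le> prob {\<omega> \<in> space M. norm (\<xi> n k \<omega>) \<le> 2 / \<sigma>}"
    proof (intro finite_measure_mono subsetI)
      fix \<omega> assume \<omega>: "\<omega> \<in> {\<omega> \<in> space M. 1 < norm (Z k \<omega>) \<and> norm (Z k \<omega>) \<le> 2 * 1}"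
      then have "w n * norm (Z k \<omega>) \<le> 1 * 2"
        using w[of n] that by (intro mult_mono) auto
      then show "\<omega> \<in> {\<omega> \<in> space M. norm (\<xi> n k \<omega>) \<le> 2 / \<sigma>}"
        using \<omega> \<sigma> by (auto simp: norm_\<xi> divide_right_mono)
    qed (use meas[OF that(2)] in \<open>simp add: norm_\<xi>\<close>)
    finally show ?thesis .
  qed
  have large: "T * (2 * (1 + \<sigma>)) powr - \<alpha> / \<kappa> * exp (- \<alpha> * real n * K2) / real n
      \<le> prob {\<omega> \<in> space M. 2 * exp (real n * K2) \<le> norm (\<xi> n 1 \<omega>)}"
    if n: "1 \<le> n" "T / real n \<le> 1" for n
  proof -
    define R where "R = 2 * exp (real n * K2)"
    have R: "1 \<le> R" using \<open>0 < K2\<close> one_le_exp_iff[of "real n * K2"] by (simp add: R_def del: one_le_exp_iff)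
    \<comment> \<open>noise of norm \<open>R\<close> needs radius \<open>R * \<sigma> / w n\<close>; the summand 1 guarantees that the radius is at least 1, beyond which the density is the power law\<close>
    let ?a = "R * (1 + \<sigma>) / w n"
    have "1 * 1 \<le> R * (1 + \<sigma>)" using R \<sigma> by (intro mult_mono) auto
    then have a: "1 \<le> ?a"
      using w[OF n] by (simp add: le_divide_eq)
    have "w n powr - \<alpha> = inverse (T / real n)"
      using n par \<alpha> by (simp add: w_def powr_powr powr_minus)
    then have "?a powr - \<alpha> = R powr - \<alpha> * (1 + \<sigma>) powr - \<alpha> * (T / real n)"
      using w[OF n] \<sigma> R by (simp add: powr_mult powr_divide)
    moreover have "R powr - \<alpha> = 2 powr - \<alpha> * exp (- \<alpha> * real n * K2)"
      unfolding R_def by (simp add: powr_mult exp_powr_real mult_ac)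
    moreover have "(2 * (1 + \<sigma>)) powr - \<alpha> = 2 powr - \<alpha> * (1 + \<sigma>) powr - \<alpha>"
      by (rule powr_mult)
    ultimately have "T * (2 * (1 + \<sigma>)) powr - \<alpha> / \<kappa> * exp (- \<alpha> * real n * K2) / real n = ?a powr - \<alpha> / \<kappa>"
      by (simp add: mult_ac)
    also have "\<dots> \<le> prob {\<omega> \<in> space M. ?a < norm (Z 1 \<omega>) \<and> norm (Z 1 \<omega>) \<le> 2 * ?a}"
      using a by (intro shell) auto
    also have "\<dots> \<le> prob {\<omega> \<in> space M. R \<le> norm (\<xi> n 1 \<omega>)}"
    proof (intro finite_measure_mono subsetI)
      fix \<omega> assume \<omega>: "\<omega> \<in> {\<omega> \<in> space M. ?a < norm (Z 1 \<omega>) \<and> norm (Z 1 \<omega>) \<le> 2 * ?a}"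
      have "R * \<sigma> \<le> R * (1 + \<sigma>)" using R by simp
      also have "\<dots> \<le> w n * norm (Z 1 \<omega>)"
        using \<omega> w[OF n] by (simp add: divide_less_eq mult.commute)
      finally show "\<omega> \<in> {\<omega> \<in> space M. R \<le> norm (\<xi> n 1 \<omega>)}"
        using \<omega> \<sigma> by (auto simp: norm_\<xi> le_divide_eq)
    qed (use meas[of 1] in \<open>simp add: norm_\<xi>\<close>)
    finally show ?thesis by (simp add: R_def)
  qed
  have "indep_vars (\<lambda>_. borel) Z {1..}"
    using Z by (simp add: iid_pareto_def)
  then have ind: "indep_vars (\<lambda>_. borel) Z {1..n}" for n
    by (rule indep_vars_subset) auto
  show ?thesis
  proof (rule superlinear_scheme_moment_explosion[where Y = "\<lambda>n. pareto_scheme \<alpha> (T / real n) x0 Z" and \<xi> = \<xi>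
        and c = "2 / \<sigma>" and C = "T * (2 * (1 + \<sigma>)) powr - \<alpha> / \<kappa>"])
    show "indep_vars (\<lambda>_. borel) (\<xi> n) {1..n}" for n
      unfolding \<xi>_def by (rule indep_vars_compose2[OF ind]) simp
  qed (use par K2 K2_eq \<open>1 \<le> \<kappa>\<close> \<sigma> large small in \<open>auto simp: \<xi>_def \<sigma>_def w_def\<close>)
qed

section \<open>Explosion of moments for both schemes\<close>

theorem theorem1p2:
  fixes M :: "'w measure" and x0 :: "'a::euclidean_space" and \<alpha> \<beta> T :: real
  assumes "prob_space M"
    and "0 < \<alpha>" and "\<alpha> < 2" and "0 < \<beta>" and "\<beta> < \<alpha>" and "0 < T"
  shows
   "(\<forall>(K :: real) (Z :: real \<Rightarrow> 'w \<Rightarrow> 'a) (p :: real \<Rightarrow> 'a \<Rightarrow> real).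
       isotropic_stable_process M \<alpha> Z \<longrightarrow>
       transition_density M Z p \<longrightarrow>
       1 \<le> K \<longrightarrow>
       heat_kernel_bounds \<alpha> K p \<longrightarrow>
       (let \<delta> = delta_const DIM('a) \<alpha> K;
            K1 = K1_const DIM('a) \<alpha> \<beta> K T;
            Y = (\<lambda>n. stable_scheme (T / real n) x0 Z n)
        in K1 < (\<delta> - ln \<delta>) / (\<alpha> - \<beta>) \<longrightarrow>
           (\<exists>C>0. \<exists>\<Omega> :: nat \<Rightarrow> 'w set.
              (\<forall>n. \<Omega> n \<in> sets M \<and> \<Omega> n \<noteq> {}) \<and>
              (\<forall>n\<ge>1. T / real n \<le> 1 \<longrightarrow>
                 exp (real n * K1) \<ge> norm x0 * (1 + ln (1 + norm x0)) \<longrightarrow>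
                 measure M (\<Omega> n) \<ge> C * exp (- \<alpha> * real n * K1) / (real n * \<delta> ^ n) \<and>
                 (\<forall>\<omega>\<in>\<Omega> n. norm (Y n \<omega>) \<ge> exp (real n * K1 + (real n - 1) * (\<delta> / \<beta>))))) \<and>
           ((\<lambda>n. \<integral>\<^sup>+\<omega>. ennreal (norm (Y n \<omega>) powr \<beta>) \<partial>M) \<longlonglongrightarrow> \<infinity>)))
    \<and>
    (\<forall>Z :: nat \<Rightarrow> 'w \<Rightarrow> 'a.
       iid_pareto M \<alpha> Z \<longrightarrow>
       (let \<kappa> = kappa_const \<alpha>;
            K2 = K2_const DIM('a) \<alpha> \<beta> T;
            Y = (\<lambda>n. pareto_scheme \<alpha> (T / real n) x0 Z n)
        in K2 < (\<kappa> - ln \<kappa>) / (\<alpha> - \<beta>) \<longrightarrow>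
           (\<exists>C>0. \<exists>\<Omega> :: nat \<Rightarrow> 'w set.
              (\<forall>n. \<Omega> n \<in> sets M \<and> \<Omega> n \<noteq> {}) \<and>
              (\<forall>n\<ge>1. T / real n \<le> 1 \<longrightarrow>
                 exp (real n * K2) \<ge> norm x0 * (1 + ln (1 + norm x0)) \<longrightarrow>
                 measure M (\<Omega> n) \<ge> C * exp (- \<alpha> * real n * K2) / (real n * \<kappa> ^ n) \<and>
                 (\<forall>\<omega>\<in>\<Omega> n. norm (Y n \<omega>) \<ge> exp (real n * K2 + (real n - 1) * (\<kappa> / \<beta>))))) \<and>
           ((\<lambda>n. \<integral>\<^sup>+\<omega>. ennreal (norm (Y n \<omega>) powr \<beta>) \<partial>M) \<longlonglongrightarrow> \<infinity>)))"
proof -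
  interpret prob_space M by fact
  show ?thesis
    unfolding Let_def isotropic_stable_process_def
    by (intro conjI[OF allI[OF allI[OF allI]] allI] impI
          stable_scheme_explosion[unfolded explodes_def] pareto_scheme_explosion[unfolded explodes_def])
      (use assms in auto)
qed

end
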